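(* There are absolute constants $\varepsilon,\delta>0$ such that, for $n$-node undirected unweighted graphs, any $+n^{\delta}$-additive $2$-FT preserver for a single pair $(s,t)$ needs $\Omega(n^{1+\varepsilon})$ edges in the worst case; i.e., there exist undirected unweighted $n$-node graphs $G$ and pairs $(s,t)$ for which every such preserver has $\Omega(n^{1+\varepsilon})$ edges.
   Context: A subgraph $H\subseteq G=(V,E)$ is a $+\beta$-additive $2$-FT preserver (spanner) for the pair $(s,t)$ if $\mathrm{dist}_{H\setminus F}(s,t)\leq \mathrm{dist}_{G\setminus F}(s,t)+\beta$ for every $F\subseteq E$ with $|F|\leq 2$. *)

theory Defs
  imports Complex_Main "HOL-Library.Extended_Real"
begin

text \<open>
  A graph is a pair of a vertex set and a set of two-element vertex sets, so it is
  undirected, unweighted, and has neither loops nor parallel edges.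
\<close>

type_synonym 'a ugraph = "'a set \<times> 'a set set"

abbreviation verts :: "'a ugraph \<Rightarrow> 'a set" where
  "verts G \<equiv> fst G"

abbreviation edges :: "'a ugraph \<Rightarrow> 'a set set" where
  "edges G \<equiv> snd G"

definition simple_graph :: "'a ugraph \<Rightarrow> bool" where
  "simple_graph G \<longleftrightarrow>
     finite (verts G) \<and> (\<forall>e\<in>edges G. e \<subseteq> verts G \<and> card e = 2)"

definition subgraph :: "'a ugraph \<Rightarrow> 'a ugraph \<Rightarrow> bool" where
  "subgraph H G \<longleftrightarrow>
     simple_graph H \<and> simple_graph G \<and> verts H \<subseteq> verts G \<and> edges H \<subseteq> edges G"

definition delete_edges :: "'a ugraph \<Rightarrow> 'a set set \<Rightarrow> 'a ugraph" where
  "delete_edges G F = (verts G, edges G - F)"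

text \<open>A walk is given by its nonempty list of successive vertices.\<close>

definition walk :: "'a ugraph \<Rightarrow> 'a \<Rightarrow> 'a list \<Rightarrow> 'a \<Rightarrow> bool" where
  "walk G s p t \<longleftrightarrow>
     p \<noteq> [] \<and> hd p = s \<and> last p = t \<and> set p \<subseteq> verts G \<and>
     successively (\<lambda>u v. {u, v} \<in> edges G) p"

text \<open>The distance is \<open>\<infinity>\<close>, the infimum of the empty set, if there is no walk.\<close>

definition graph_dist :: "'a ugraph \<Rightarrow> 'a \<Rightarrow> 'a \<Rightarrow> enat" where
  "graph_dist G s t = (INF p \<in> {p. walk G s p t}. enat (length p - 1))"

text \<open>
  The stretch \<open>\<beta>\<close> is real, so the distances are compared in the extended reals; when
  \<open>t\<close> is unreachable from \<open>s\<close> in \<open>G\<close> minus \<open>F\<close>, the inequality holds trivially.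
\<close>

definition additive_ft_preserver ::
  "nat \<Rightarrow> real \<Rightarrow> 'a ugraph \<Rightarrow> 'a \<Rightarrow> 'a \<Rightarrow> 'a ugraph \<Rightarrow> bool" where
  "additive_ft_preserver f \<beta> G s t H \<longleftrightarrow>
     subgraph H G \<and>
     (\<forall>F. F \<subseteq> edges G \<and> finite F \<and> card F \<le> f \<longrightarrow>
        ereal_of_enat (graph_dist (delete_edges H F) s t)
          \<le> ereal_of_enat (graph_dist (delete_edges G F) s t) + ereal \<beta>)"

end

theory Submission
  imports Defs "HOL-Library.Product_Plus" "HOL-Library.Countable" "HOL-Real_Asymp.Real_Asymp"
begin

text \<open>
  Consider the straight segments from \<open>(0, h u)\<close> to \<open>(h, h v)\<close> in a layered copy of
  \<open>\<int>\<^sup>3\<close>, where a step of slope \<open>w\<close> costs a constant plus \<open>2b |w|\<^sup>2\<close>. By strict convexity the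
  segment of constant slope \<open>v - u\<close> is the unique shortest path between its ends, with a margin
  of \<open>2b\<close>. In the product of two such spaces, walked by alternate steps, every step is
  shared by many pairs of segments, but the turn from a step in the first space to the next step in
  the second one determines both segments. So every pair of end points owns \<open>h\<close> private turns, and
  a subgraph that lacks \<open>b\<close> of them stretches the distance of the pair by at least \<open>2b\<close>.

  One fault on each of two trunks selects a source and a target: the fault forces the route to
  leave the trunk before it, and the exits get shorter along the trunk. Exit lengths have to
  compensate the variation of the distances inside the core, which would make them too long.
  Therefore the core is used in \<open>q\<^sup>2\<close> copies \<open>(a, c)\<close>, where the sources depend only on \<open>a\<close> and the targets
  only on \<open>c\<close>: most consecutive exits then differ only in the copy, where a gap of \<open>2b + 1\<close> is enough.

  All lower bounds on distances are certified by 1-Lipschitz potentials. The potential is the linear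
  functional that is tight on the selected path plus a correction that grows by 2 at each missing turn.
\<close>

section \<open>Distance bounds from Lipschitz potentials\<close>

lemma walk_potential_bound:
  fixes \<phi> :: "'a \<Rightarrow> real"
  assumes "walk G s p t"
    and "\<And>x y. {x, y} \<in> edges G \<Longrightarrow> \<bar>\<phi> x - \<phi> y\<bar> \<le> 1"
  shows "\<phi> t - \<phi> s \<le> real (length p - 1)"
proof -
  have "p \<noteq> [] \<Longrightarrow> successively (\<lambda>u v. {u, v} \<in> edges G) p \<Longrightarrow>
      \<phi> (last p) - \<phi> (hd p) \<le> real (length p - 1)" for p
  proof (induction p)
    case (Cons a p)
    show ?case
    proof (cases p)
      case (Cons a' p')
      have "{a, a'} \<in> edges G" "\<phi> (last p) - \<phi> a' \<le> real (length p - 1)"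
        using Cons.IH Cons.prems Cons by auto
      then show ?thesis
        using assms(2)[of a a'] Cons by auto
    qed simp
  qed simp
  then show ?thesis
    using assms(1) by (auto simp: walk_def)
qed

lemma walk_trans:
  assumes "walk G a p b" "walk G b p' c"
  shows "\<exists>p''. walk G a p'' c \<and> length p'' - 1 = (length p - 1) + (length p' - 1)"
proof -
  obtain ys where p': "p' = b # ys"
    using assms(2) by (cases p') (auto simp: walk_def)
  have "walk G a (p @ ys) c"
    using assms p' by (cases ys) (auto simp: walk_def successively_append_iff)
  moreover have "length (p @ ys) - 1 = (length p - 1) + (length p' - 1)"
    using assms(1) p' by (cases p) (auto simp: walk_def)
  ultimately show ?thesis by blast
qed

text \<open>The walk bounds the distance in \<open>G\<close> minus \<open>F\<close> from above, and
  the potential bounds the distance in \<open>H\<close> minus \<open>F\<close> from below. It has to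
  be Lipschitz only on edges that \<open>H\<close> kept.\<close>

lemma preserver_contradiction:
  fixes \<phi> :: "'a \<Rightarrow> real"
  assumes pres: "additive_ft_preserver f \<beta> G s t H"
    and F: "F \<subseteq> edges G" "finite F" "card F \<le> f"
    and walk: "walk (delete_edges G F) s p t"
    and lip: "\<And>x y. {x, y} \<in> edges H - F \<Longrightarrow> \<bar>\<phi> x - \<phi> y\<bar> \<le> 1"
    and gap: "\<phi> t - \<phi> s > real (length p - 1) + \<beta>"
  shows False
proof -
  define d where "d = length p - 1"
  let ?H = "graph_dist (delete_edges H F) s t" and ?G = "graph_dist (delete_edges G F) s t"
  have le: "ereal_of_enat ?H \<le> ereal_of_enat ?G + ereal \<beta>"
    using pres F by (auto simp: additive_ft_preserver_def)
  have "?G \<le> enat d"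
    unfolding graph_dist_def d_def using walk by (intro INF_lower) auto
  then have H_le: "ereal_of_enat ?H \<le> ereal (real d) + ereal \<beta>"
    using le by (metis (no_types, lifting) add_right_mono ereal_of_enat_le_iff ereal_of_enat_simps(1) order_trans)
  then obtain k where k: "?H = enat k" by (cases ?H) auto
  have ne: "{p. walk (delete_edges H F) s p t} \<noteq> {}"
  proof
    assume "{p. walk (delete_edges H F) s p t} = {}"
    then have "?H = \<infinity>" unfolding graph_dist_def by (simp only:) (simp add: top_enat_def)
    then show False using k by simp
  qed
  have "?H \<in> (\<lambda>p. enat (length p - 1)) ` {p. walk (delete_edges H F) s p t}"
    unfolding graph_dist_def Inf_enat_def using ne by (auto intro: LeastI)
  then obtain p' where p': "walk (delete_edges H F) s p' t" "?H = enat (length p' - 1)"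
    by auto
  have "\<phi> t - \<phi> s \<le> real (length p' - 1)"
    using p'(1) lip by (intro walk_potential_bound) (auto simp: delete_edges_def)
  moreover have "real (length p' - 1) \<le> real d + \<beta>"
    using H_le p'(2) by simp
  ultimately show False using gap by (simp add: d_def)
qed

section \<open>Subdivision of arcs of prescribed length\<close>

text \<open>
  An arc of length \<open>l\<close> is a path with \<open>l\<close> edges. Encoding its vertices in \<open>nat\<close> leaves
  room for isolated vertices, so every sufficiently large order \<open>n\<close> is attained.
\<close>

definition nd :: "'n::countable \<Rightarrow> nat" where
  "nd u = to_nat (Inl u :: 'n + 'n \<times> 'n \<times> nat \<times> nat)"

definition pt :: "'n::countable \<Rightarrow> 'n \<Rightarrow> nat \<Rightarrow> nat \<Rightarrow> nat" where
  "pt u v l j = (if j = 0 then nd u else if j = l then nd v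
                 else to_nat (Inr (u, v, l, j) :: 'n + 'n \<times> 'n \<times> nat \<times> nat))"

lemma nd_eq_iff [simp]: "nd u = nd v \<longleftrightarrow> u = v"
  by (simp add: nd_def)

lemma inj_nd: "inj nd"
  by (auto intro: injI)

locale subdivision =
  fixes arc :: "'n::countable \<Rightarrow> 'n \<Rightarrow> nat \<Rightarrow> bool" and X :: "nat set"
  assumes arc_neq: "arc u v l \<Longrightarrow> u \<noteq> v"
    and arc_pos: "arc u v l \<Longrightarrow> 0 < l"
    and finite_X: "finite X"
    and pt_in_X: "arc u v l \<Longrightarrow> j \<le> l \<Longrightarrow> pt u v l j \<in> X"
begin

definition G :: "nat ugraph" where
  "G = (X, {{pt u v l j, pt u v l (Suc j)} |u v l j. arc u v l \<and> j < l})"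

lemma edges_G_I: "arc u v l \<Longrightarrow> j < l \<Longrightarrow> {pt u v l j, pt u v l (Suc j)} \<in> edges G"
  by (auto simp: G_def)

lemma pt_Suc_neq: "arc u v l \<Longrightarrow> j < l \<Longrightarrow> pt u v l j \<noteq> pt u v l (Suc j)"
  using arc_neq by (auto simp: pt_def nd_def)

lemma simple_G: "simple_graph G"
proof -
  have "e \<subseteq> X \<and> card e = 2" if "e \<in> edges G" for e
  proof -
    obtain u v l j where e: "e = {pt u v l j, pt u v l (Suc j)}" "arc u v l" "j < l"
      using \<open>e \<in> edges G\<close> by (auto simp: G_def)
    then show ?thesis
      using pt_Suc_neq pt_in_X by auto
  qed
  then show ?thesis
    by (simp add: simple_graph_def finite_X) (simp add: G_def finite_X)
qed

text \<open>Interior vertices carry the tag \<open>Inr\<close>, so an edge between two nodes is an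
  entire arc of length 1. Hence node pairs can name deleted edges without touching longer
  arcs.\<close>

lemma pt_edge_eq_nd:
  assumes "arc u v l" "j < l" "{pt u v l j, pt u v l (Suc j)} = nd ` e"
  shows "l = 1" "e = {u, v}"
proof -
  have *: "i = 0 \<or> i = l" if "pt u v l i \<in> nd ` e" for i
    using that by (auto simp: pt_def nd_def split: if_splits)
  have "pt u v l j \<in> nd ` e" "pt u v l (Suc j) \<in> nd ` e"
    using assms(3) by auto
  then have "j = 0" "Suc j = l"
    using * assms(2) by fastforce+
  then show "l = 1" by simp
  have "nd ` {u, v} = nd ` e"
    using assms(3) \<open>j = 0\<close> \<open>Suc j = l\<close> by (auto simp: pt_def)
  then show "e = {u, v}"
    by (metis inj_image_eq_iff inj_nd)
qed

inductive path_avoiding :: "'n set set \<Rightarrow> 'n \<Rightarrow> 'n \<Rightarrow> nat \<Rightarrow> bool" for R where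
  arcI: "arc u v l \<Longrightarrow> {u, v} \<notin> R \<Longrightarrow> path_avoiding R u v l"
| transI: "path_avoiding R u v k \<Longrightarrow> path_avoiding R v w l \<Longrightarrow> path_avoiding R u w (k + l)"

lemma path_avoiding_walk:
  "path_avoiding R u v l \<Longrightarrow>
     \<exists>p. walk (delete_edges G ((`) nd ` R)) (nd u) p (nd v) \<and> length p - 1 = l"
proof (induction rule: path_avoiding.induct)
  case (arcI u v l)
  let ?p = "map (pt u v l) [0..<Suc l]"
  have "0 < l" using arcI arc_pos by blast
  have "successively (\<lambda>x y. {x, y} \<in> edges G - (`) nd ` R) ?p"
    unfolding successively_conv_nth
  proof (intro allI impI)
    fix j assume "Suc j < length ?p"
    then have "j < l" by simp
    then have "{pt u v l j, pt u v l (Suc j)} \<notin> (`) nd ` R"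
      using arcI pt_edge_eq_nd(2) by blast
    then show "{?p ! j, ?p ! Suc j} \<in> edges G - (`) nd ` R"
      using edges_G_I[OF arcI(1) \<open>j < l\<close>] \<open>j < l\<close> by (simp add: nth_map_upt del: upt_Suc)
  qed
  moreover have "set ?p \<subseteq> X"
    using pt_in_X[OF arcI(1)] by auto
  moreover have "hd ?p = nd u" "last ?p = nd v"
    using \<open>0 < l\<close> by (auto simp: pt_def hd_map hd_append)
  ultimately have "walk (delete_edges G ((`) nd ` R)) (nd u) ?p (nd v)"
    by (simp add: walk_def delete_edges_def) (simp add: G_def)
  moreover have "length ?p - 1 = l" by simp
  ultimately show ?case by blast
next
  case (transI u v k w l)
  then show ?case using walk_trans by metis
qed

definition interpolation :: "('n \<Rightarrow> int) \<Rightarrow> nat \<Rightarrow> real" where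
  "interpolation \<phi> x = (case from_nat x :: 'n + 'n \<times> 'n \<times> nat \<times> nat of
     Inl u \<Rightarrow> of_int (\<phi> u)
   | Inr (u, v, l, j) \<Rightarrow> of_int (\<phi> u) + real j * (of_int (\<phi> v) - of_int (\<phi> u)) / real l)"

lemma interpolation_nd: "interpolation \<phi> (nd u) = of_int (\<phi> u)"
  by (simp add: interpolation_def nd_def)

lemma interpolation_pt:
  assumes "0 < l"
  shows "interpolation \<phi> (pt u v l j) =
           of_int (\<phi> u) + real j * (of_int (\<phi> v) - of_int (\<phi> u)) / real l"
proof (cases "j = 0 \<or> j = l")
  case True
  then show ?thesis using assms by (auto simp: pt_def interpolation_nd)
next
  case False
  then show ?thesis by (simp add: pt_def interpolation_def)
qed

text \<open>Each edge of an arc changes the interpolated value by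
  \<open>(\<phi> v - \<phi> u) / l\<close> up to sign. An arc named by \<open>R\<close> has length
  1, so its only edge is excluded and imposes no condition.\<close>

lemma interpolation_lipschitz:
  assumes "{x, y} \<in> edges G - (`) nd ` R"
    and len: "\<And>u v l. arc u v l \<Longrightarrow> {u, v} \<in> R \<Longrightarrow> l = 1"
    and lip: "\<And>u v l. arc u v l \<Longrightarrow> {u, v} \<notin> R \<Longrightarrow> \<bar>\<phi> v - \<phi> u\<bar> \<le> int l"
  shows "\<bar>interpolation \<phi> x - interpolation \<phi> y\<bar> \<le> 1"
proof -
  obtain u v l j where e: "{x, y} = {pt u v l j, pt u v l (Suc j)}" "arc u v l" "j < l"
    using assms(1) by (auto simp: G_def)
  have "{u, v} \<notin> R"
  proof
    assume R: "{u, v} \<in> R"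
    then have "l = 1" using e len by blast
    then have "{x, y} = nd ` {u, v}" using e by (simp add: pt_def)
    then show False using assms(1) R by blast
  qed
  then have "\<bar>\<phi> v - \<phi> u\<bar> \<le> int l" using e lip by blast
  then have *: "\<bar>of_int (\<phi> v) - of_int (\<phi> u)\<bar> \<le> real l" by linarith
  have "0 < l" using e by simp
  have "interpolation \<phi> (pt u v l (Suc j)) - interpolation \<phi> (pt u v l j) =
      (of_int (\<phi> v) - of_int (\<phi> u)) / real l"
    using \<open>0 < l\<close> by (simp add: interpolation_pt field_simps)
  then have "\<bar>interpolation \<phi> (pt u v l (Suc j)) - interpolation \<phi> (pt u v l j)\<bar> \<le> 1"
    using * \<open>0 < l\<close> by (simp add: abs_div)
  then show ?thesis
    using e(1) by (auto simp: doubleton_eq_iff abs_minus_commute)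
qed

text \<open>Missing critical edges act like further deletions: \<open>b\<close> of them admit a
  potential with gap \<open>d + 2 * b\<close>, while a path of length \<open>d\<close> survives the
  faults in \<open>G\<close>.\<close>

lemma few_missing_edges:
  assumes pres: "additive_ft_preserver f \<beta> G (nd s) (nd t) H"
    and R: "finite R" "card R \<le> f" "\<And>e. e \<in> R \<Longrightarrow> \<exists>u v. e = {u, v} \<and> arc u v 1"
    and path: "path_avoiding R s t d"
    and "finite J" "\<beta> < 2 * real b"
    and len: "\<And>u v l. arc u v l \<Longrightarrow> {u, v} \<in> R \<union> crit ` J \<Longrightarrow> l = 1"
    and pot: "\<And>Z. Z \<subseteq> J \<Longrightarrow> card Z = b \<Longrightarrow>
       \<exists>\<phi> :: 'n \<Rightarrow> int. \<phi> t - \<phi> s = int d + 2 * int b \<and>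
         (\<forall>u v l. arc u v l \<longrightarrow> {u, v} \<notin> R \<union> crit ` Z \<longrightarrow> \<bar>\<phi> v - \<phi> u\<bar> \<le> int l)"
  shows "card {i \<in> J. nd ` crit i \<notin> edges H} < b"
proof (rule ccontr)
  let ?F = "(`) nd ` R"
  assume "\<not> ?thesis"
  then obtain Z where Z: "Z \<subseteq> {i \<in> J. nd ` crit i \<notin> edges H}" "card Z = b"
    by (meson not_less obtain_subset_with_card_n)
  then obtain \<phi> :: "'n \<Rightarrow> int" where \<phi>: "\<phi> t - \<phi> s = int d + 2 * int b"
    "\<And>u v l. arc u v l \<Longrightarrow> {u, v} \<notin> R \<union> crit ` Z \<Longrightarrow> \<bar>\<phi> v - \<phi> u\<bar> \<le> int l"
    using pot[of Z] by blast
  obtain p where p: "walk (delete_edges G ?F) (nd s) p (nd t)" "length p - 1 = d"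
    using path_avoiding_walk[OF path] by blast
  have sub: "edges H \<subseteq> edges G"
    using pres by (simp add: additive_ft_preserver_def subgraph_def)
  show False
  proof (rule preserver_contradiction[OF pres _ _ _ p(1), of "interpolation \<phi>"])
    show "?F \<subseteq> edges G"
    proof
      fix e assume "e \<in> ?F"
      then obtain u v where "e = nd ` {u, v}" "arc u v 1" using R(3) by blast
      then show "e \<in> edges G" using edges_G_I[of u v 1 0] by (simp add: pt_def)
    qed
    show "finite ?F" using R by simp
    show "card ?F \<le> f" using R card_image_le le_trans by blast
    have "real_of_int (\<phi> t) - real_of_int (\<phi> s) = real d + 2 * real b"
      using arg_cong[OF \<phi>(1), of real_of_int] by simp
    then show "real (length p - 1) + \<beta> < interpolation \<phi> (nd t) - interpolation \<phi> (nd s)"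
      using assms(7) p(2) by (simp add: interpolation_nd)
  next
    fix x y assume xy: "{x, y} \<in> edges H - ?F"
    have "{x, y} \<notin> (`) nd ` (R \<union> crit ` Z)"
      using xy Z by auto
    then have "{x, y} \<in> edges G - (`) nd ` (R \<union> crit ` Z)" using xy sub by blast
    then show "\<bar>interpolation \<phi> x - interpolation \<phi> y\<bar> \<le> 1"
      by (rule interpolation_lipschitz) (use Z len \<phi>(2) in blast)+
  qed
qed

end

section \<open>Inner products and boxes in the integer lattice\<close>

type_synonym vec = "int \<times> int \<times> int"

fun ip :: "vec \<Rightarrow> vec \<Rightarrow> int" where
  "ip (x, y, z) (x', y', z') = x * x' + y * y' + z * z'"

fun smul :: "int \<Rightarrow> vec \<Rightarrow> vec" where
  "smul k (x, y, z) = (k * x, k * y, k * z)"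

definition box :: "int \<Rightarrow> vec set" where
  "box m = {0..<m} \<times> {0..<m} \<times> {0..<m}"

lemma ip_add: "ip w (u + v) = ip w u + ip w v"
  by (cases w; cases u; cases v) (simp add: algebra_simps)

lemma ip_smul: "ip w (smul k u) = k * ip w u"
  by (cases w; cases u) (simp add: algebra_simps)

lemma ip_diff_self: "ip (w - w') (w - w') = ip w w - 2 * ip w' w + ip w' w'"
  by (cases w; cases w') (simp add: algebra_simps)

lemma ip_self_nonneg: "0 \<le> ip w w"
  by (cases w) simp

text \<open>Integrality turns strict convexity of the squared norm into a uniform margin between
  distinct slopes.\<close>

lemma ip_self_pos: "w \<noteq> 0 \<Longrightarrow> 1 \<le> ip w w"
proof -
  assume "w \<noteq> 0"
  obtain x y z where w: "w = (x, y, z)" by (cases w)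
  have "x\<^sup>2 + y\<^sup>2 + z\<^sup>2 \<noteq> 0"
    using \<open>w \<noteq> 0\<close> w by (simp add: zero_prod_def add_nonneg_eq_0_iff)
  moreover have "0 \<le> x\<^sup>2 + y\<^sup>2 + z\<^sup>2" by simp
  ultimately have "1 \<le> x\<^sup>2 + y\<^sup>2 + z\<^sup>2" by linarith
  then show ?thesis by (simp add: w power2_eq_square)
qed

lemma ip_box:
  assumes "u \<in> box k" "v \<in> box l"
  shows "0 \<le> ip u v" "ip u v \<le> 3 * (k * l)"
proof -
  have *: "0 \<le> x * y" "x * y \<le> k * l" if "x \<in> {0..<k}" "y \<in> {0..<l}" for x y :: int
    using that by (auto intro: mult_mono)
  show "0 \<le> ip u v"
    using assms by (cases u; cases v) (auto simp: box_def)
  obtain x y z x' y' z' where uv: "u = (x, y, z)" "v = (x', y', z')"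
    by (cases u; cases v)
  show "ip u v \<le> 3 * (k * l)"
    using assms *(2)[of x x'] *(2)[of y y'] *(2)[of z z'] by (auto simp: uv box_def)
qed

lemma smul_add_left: "smul (k + l) u = smul k u + smul l u"
  by (cases u) (simp add: algebra_simps)

lemma smul_add: "smul k (u + v) = smul k u + smul k v"
  by (cases u; cases v) (simp add: algebra_simps)

lemma smul_0 [simp]: "smul 0 u = 0"
  by (cases u) (simp add: zero_prod_def)

lemma smul_1 [simp]: "smul 1 u = u"
  by (cases u) simp

lemma smul_inject: "k \<noteq> 0 \<Longrightarrow> smul k u = smul k v \<longleftrightarrow> u = v"
  by (cases u; cases v) simp

lemma segment_in_box:
  assumes "u \<in> box k" "v \<in> box k" "0 \<le> i" "i \<le> n" "0 < n"
  shows "smul n u + smul i (v - u) \<in> box (n * k)"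
proof -
  have *: "n * x + i * (y - x) \<in> {0..<n * k}" if "x \<in> {0..<k}" "y \<in> {0..<k}" for x y :: int
  proof -
    have "(n - i) * x \<le> (n - i) * (k - 1)" "i * y \<le> i * (k - 1)"
      using that assms by (auto intro: mult_left_mono)
    moreover have "0 \<le> (n - i) * x" "0 \<le> i * y"
      using that assms by auto
    ultimately show ?thesis
      using \<open>0 < n\<close> by (auto simp: algebra_simps)
  qed
  then show ?thesis
    using assms by (cases u; cases v) (simp add: box_def)
qed

lemma finite_box [simp]: "finite (box k)"
  by (simp add: box_def)

lemma card_box: "card (box (int k)) = k ^ 3"
  by (simp add: box_def card_cartesian_product power3_eq_cube)

section \<open>The weighted graph: trunks, grids and turns\<close>

text \<open>\<open>LPort\<close> stores the position before the left step and its slope,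
  \<open>RPort\<close> the position after the left step and the slope of the right step to come. So
  a turn between them determines both slopes.\<close>

datatype node = Src nat | Tgt nat | Hub nat nat nat vec vec
  | LPort nat nat nat vec vec vec | RPort nat nat nat vec vec vec

instance node :: countable
  by countable_datatype

locale grid =
  fixes b h r q :: nat and enum :: "nat \<Rightarrow> vec \<times> vec"
  assumes b_pos: "0 < b" and h_pos: "0 < h" and r_pos: "0 < r" and q_pos: "0 < q"
    and bij_enum: "bij_betw enum {..<(2 * r) ^ 6} (box (int (2 * r)) \<times> box (int (2 * r)))"
begin

text \<open>An index \<open>k\<close> stands for the end point \<open>enum (k div q)\<close> in copy
  \<open>k mod q\<close>; the \<open>q\<close> copies of an end point are consecutive on a
  trunk.\<close>

definition "N = q * (2 * r) ^ 6"

text \<open>Bounds the variation of \<open>base\<close> over the end points: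
  \<open>4 * b * h\<close> times the range of two inner products, each between 0 and
  \<open>6 * r^2\<close>.\<close>

definition "V = 48 * b * h * r\<^sup>2"

text \<open>Leaving one exit earlier saves one trunk edge, so the gap \<open>2 * b + 1\<close>
  leaves \<open>2 * b\<close> for the correction. An extra \<open>V\<close> is due only when the end
  point changes; the constant \<open>V + 2 * b\<close> serves the exits cut off by a fault.\<close>

definition off :: "nat \<Rightarrow> nat" where
  "off k = V + 2 * b + (N - k) * (2 * b + 1) + ((2 * r) ^ 6 - k div q) * V"

definition ell :: "vec \<Rightarrow> nat" where
  "ell w = nat (2 * int b * (3 * (int r)\<^sup>2 + ip w w))"

definition "pos k = map_prod (smul (int h)) (smul (int h)) (enum (k div q))"

definition "dir k j = enum (j div q) - enum (k div q)"

definition "point k j i = pos k + map_prod (smul (int i)) (smul (int i)) (dir k j)"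

text \<open>The copies share the hubs of layer \<open>0\<close> for equal \<open>a\<close> and those of layer \<open>h\<close> for equal \<open>c\<close>.\<close>

definition hub :: "nat \<Rightarrow> nat \<Rightarrow> nat \<Rightarrow> vec \<Rightarrow> vec \<Rightarrow> node" where
  "hub i a c = Hub i (if i = h then 0 else a) (if i = 0 then 0 else c)"

abbreviation "M \<equiv> box (int (2 * h * r))"

inductive arc :: "node \<Rightarrow> node \<Rightarrow> nat \<Rightarrow> bool" where
  arc_src: "k < N \<Longrightarrow> arc (Src k) (Src (Suc k)) 1"
| arc_exit: "k < N \<Longrightarrow> arc (Src k) (hub 0 (k mod q) 0 (fst (pos k)) (snd (pos k))) (off k)"
| arc_left: "i < h \<Longrightarrow> a < q \<Longrightarrow> c < q \<Longrightarrow> x \<in> M \<Longrightarrow> y \<in> M \<Longrightarrow> w \<in> box (int r) \<Longrightarrow>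
    arc (hub i a c x y) (LPort i a c x y w) (ell w)"
| arc_turn: "i < h \<Longrightarrow> a < q \<Longrightarrow> c < q \<Longrightarrow> x \<in> M \<Longrightarrow> x + w \<in> M \<Longrightarrow> y \<in> M \<Longrightarrow>
    w \<in> box (int r) \<Longrightarrow> w' \<in> box (int r) \<Longrightarrow>
    arc (LPort i a c x y w) (RPort i a c (x + w) y w') 1"
| arc_right: "i < h \<Longrightarrow> a < q \<Longrightarrow> c < q \<Longrightarrow> x \<in> M \<Longrightarrow> y \<in> M \<Longrightarrow> y + w \<in> M \<Longrightarrow>
    w \<in> box (int r) \<Longrightarrow> arc (RPort i a c x y w) (hub (Suc i) a c x (y + w)) (ell w)"
| arc_enter: "k < N \<Longrightarrow> arc (hub h 0 (k mod q) (fst (pos k)) (snd (pos k))) (Tgt k) (off k)"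
| arc_tgt: "k < N \<Longrightarrow> arc (Tgt (Suc k)) (Tgt k) 1"

definition "crit k j i =
  {LPort i (k mod q) (j mod q) (fst (point k j i)) (snd (point k j i)) (fst (dir k j)),
   RPort i (k mod q) (j mod q) (fst (point k j (Suc i))) (snd (point k j i)) (snd (dir k j))}"

lemma int_ell: "int (ell w) = 2 * int b * (3 * (int r)\<^sup>2 + ip w w)"
  using ip_self_nonneg[of w] by (simp add: ell_def)

lemma ell_pos: "0 < ell w"
  using b_pos r_pos ip_self_nonneg[of w] by (simp add: ell_def add_pos_nonneg)

lemma div_q_less: "k < N \<Longrightarrow> k div q < (2 * r) ^ 6"
  by (simp add: N_def less_mult_imp_div_less mult.commute)

lemma enum_box:
  assumes "k < N"
  shows "fst (enum (k div q)) \<in> box (int (2 * r))" "snd (enum (k div q)) \<in> box (int (2 * r))"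
  using bij_betwE[OF bij_enum] div_q_less[OF assms] by (auto simp: mem_Times_iff)

lemma off_ge: "int V + 2 * int b \<le> int (off k)"
  by (simp add: off_def)

lemma off_gap:
  assumes "k' < k" "k < N"
  shows "int (off k) + (int k - int k') * (2 * int b + 1) \<le> int (off k')"
    and "k' div q \<noteq> k div q \<Longrightarrow>
           int (off k) + (int k - int k') * (2 * int b + 1) + int V \<le> int (off k')"
proof -
  have k: "k div q < (2 * r) ^ 6" "k' div q \<le> k div q"
    using assms div_q_less by (auto intro: div_le_mono)
  have e: "int (off l) = int V + 2 * int b + (int N - int l) * (2 * int b + 1) +
      (int ((2 * r) ^ 6) - int (l div q)) * int V" if "l \<le> k" for l
  proof -
    have "l \<le> N" "l div q \<le> (2 * r) ^ 6"
      using that assms k div_le_mono[OF that, of q] by linarith+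
    then have "int (N - l) = int N - int l"
      "int ((2 * r) ^ 6 - l div q) = int ((2 * r) ^ 6) - int (l div q)"
      by (simp_all add: of_nat_diff)
    then show ?thesis
      unfolding off_def of_nat_add of_nat_mult by simp
  qed
  have e': "int (off k') = int (off k) + (int k - int k') * (2 * int b + 1) +
      (int (k div q) - int (k' div q)) * int V"
    using e[of k] e[of k'] assms(1) by (simp add: algebra_simps)
  have "0 \<le> (int (k div q) - int (k' div q)) * int V"
    using k by simp
  then show "int (off k) + (int k - int k') * (2 * int b + 1) \<le> int (off k')"
    using e' by linarith
  assume "k' div q \<noteq> k div q"
  then have "1 * int V \<le> (int (k div q) - int (k' div q)) * int V"
    using k by (intro mult_right_mono) auto
  then show "int (off k) + (int k - int k') * (2 * int b + 1) + int V \<le> int (off k')"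
    using e' by linarith
qed

text \<open>Completing the square: without \<open>D\<close>, the upper bound has slack
  \<open>2 * int b * ip (w - w') (w - w')\<close>, which vanishes at \<open>w'\<close> and is at
  least \<open>2 * int b\<close> elsewhere, enough to pay for \<open>D\<close>. The constant
  \<open>3 * r^2\<close> in \<open>ell\<close> is what gives the lower bound.\<close>

lemma step_bound:
  assumes "w \<in> box (int r)" "w' \<in> box (int r)" "\<bar>D\<bar> \<le> 2 * int b" "w = w' \<Longrightarrow> D \<le> 0"
  shows "\<bar>2 * int b * (3 * (int r)\<^sup>2) + 4 * int b * ip w' w - 2 * int b * ip w' w' + D\<bar> \<le> int (ell w)"
proof -
  define S where "S = 2 * int b * ip (w - w') (w - w')"
  have S: "S = 2 * int b * ip w w - 4 * int b * ip w' w + 2 * int b * ip w' w'"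
    by (simp add: S_def ip_diff_self algebra_simps)
  have "0 \<le> S" by (simp add: S_def ip_self_nonneg)
  moreover have "2 * int b \<le> S" if "w \<noteq> w'"
    using that mult_left_mono[OF ip_self_pos, of "w - w'" "2 * int b"] by (simp add: S_def)
  ultimately have "D \<le> S" using assms(3,4) by (cases "w = w'") auto
  have "ip w' w' + 1 \<le> 6 * (int r)\<^sup>2"
  proof -
    have "1 \<le> (int r)\<^sup>2" using r_pos by (simp add: int_one_le_iff_zero_less)
    then show ?thesis using ip_box(2)[OF assms(2,2)] by (simp add: power2_eq_square)
  qed
  then have "2 * int b * (ip w' w' + 1) \<le> 2 * int b * (6 * (int r)\<^sup>2)"
    by (intro mult_left_mono) auto
  moreover have "0 \<le> 4 * int b * ip w' w" "0 \<le> 2 * int b * ip w w"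
    using ip_box(1)[OF assms(2,1)] ip_self_nonneg by auto
  ultimately show ?thesis
    using S \<open>D \<le> S\<close> assms(3) by (simp add: int_ell algebra_simps abs_le_iff)
qed

end

section \<open>The potential for one selected pair\<close>

locale grid_test = grid +
  fixes k0 j0 :: nat
  assumes k0: "k0 < N" and j0: "j0 < N"
    and dir: "dir k0 j0 \<in> box (int r) \<times> box (int r)"
begin

abbreviation "a0 \<equiv> k0 mod q"
abbreviation "c0 \<equiv> j0 mod q"

definition "w1 = fst (dir k0 j0)"
definition "w2 = snd (dir k0 j0)"
definition "px i = fst (point k0 j0 i)"
definition "py i = snd (point k0 j0 i)"

lemma w1: "w1 \<in> box (int r)" and w2: "w2 \<in> box (int r)"
  using dir by (auto simp: w1_def w2_def mem_Times_iff)

lemma px_Suc: "px (Suc i) = px i + w1" and py_Suc: "py (Suc i) = py i + w2"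
  by (simp_all add: px_def py_def point_def w1_def w2_def smul_add_left ac_simps del: smul.simps)

lemma pos_k0: "pos k0 = (px 0, py 0)"
  by (simp add: px_def py_def point_def)

lemma px_eq: "px i = px 0 + smul (int i) w1" and py_eq: "py i = py 0 + smul (int i) w2"
  by (simp_all add: px_def py_def point_def w1_def w2_def)

lemma pos_j0: "pos j0 = (px h, py h)"
  by (simp add: px_def py_def point_def pos_def dir_def map_prod_def split_beta flip: smul_add)

lemma px_in: "i \<le> h \<Longrightarrow> px i \<in> M" and py_in: "i \<le> h \<Longrightarrow> py i \<in> M"
  using segment_in_box[of "fst (enum (k0 div q))" "int (2 * r)" "fst (enum (j0 div q))" "int i" "int h"]
    segment_in_box[of "snd (enum (k0 div q))" "int (2 * r)" "snd (enum (j0 div q))" "int i" "int h"]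
    enum_box[OF k0] enum_box[OF j0] h_pos
  by (simp_all add: px_def py_def point_def pos_def dir_def map_prod_def split_beta ac_simps)

text \<open>The faults cut the source trunk right after the exit of \<open>k0\<close> and the target
  trunk right before the entrance of \<open>j0\<close>.\<close>

definition "faults = {{Src k0, Src (Suc k0)}, {Tgt (Suc j0), Tgt j0}}"

lemma crit_eq:
  "crit k0 j0 i = {LPort i a0 c0 (px i) (py i) w1, RPort i a0 c0 (px (Suc i)) (py i) w2}"
  by (simp add: crit_def px_def py_def w1_def w2_def)

definition "len = ell w1 + 1 + ell w2"

text \<open>The tangent to the step costs at \<open>w1\<close> and \<open>w2\<close>: the gradients
  \<open>4 * b * w1\<close> and \<open>4 * b * w2\<close> are those of \<open>2 * b * |w|^2\<close>,
  and the term in \<open>i\<close> makes a round of the selected segment gain exactly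
  \<open>len\<close>.\<close>

definition "base i x y = int i * (12 * int b * (int r)\<^sup>2 + 1 - 2 * int b * (ip w1 w1 + ip w2 w2)) +
  4 * int b * (ip w1 x + ip w2 y)"

definition "z Z i = 2 * int (card (Z \<inter> {..<i}))"

definition "K0 = int k0 + int (off k0)"
definition "K1 = K0 + int h * int len + 2 * int b"

text \<open>
  \<open>Z\<close> is the set of rounds whose turn is missing. At such a turn only the left port on the path and
  the right ports off the path keep the value \<open>z Z i\<close>, the other ones get \<open>z Z (Suc i)\<close>; hence no other
  arc of the turn increases the correction.
\<close>

definition "\<theta> Z i a c x y =
  (if 0 < i \<and> c \<noteq> c0 then 0 else if a = a0 \<and> x = px i \<and> y = py i then z Z i else 2 * int b)"

text \<open>The cut-off trunk parts get the constants \<open>K0\<close> and \<open>K1\<close>. The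
  constants at the ports split the growth of \<open>base\<close> per layer between the left step,
  the turn and the right step.\<close>

definition \<phi> :: "nat set \<Rightarrow> node \<Rightarrow> int" where
  "\<phi> Z n = (case n of
     Src k \<Rightarrow> if k \<le> k0 then int k else K0
   | Hub i a c x y \<Rightarrow> K0 + (base i x y - base 0 (px 0) (py 0)) + \<theta> Z i a c x y
   | LPort i a c x y w \<Rightarrow>
       K0 + (base i (x + w) y - base 0 (px 0) (py 0)) + 2 * int b * (3 * (int r)\<^sup>2 - ip w1 w1) +
       (if c \<noteq> c0 then 0
        else if a = a0 \<and> x + w = px (Suc i) \<and> y = py i then if w = w1 then z Z i else z Z (Suc i)
        else 2 * int b)
   | RPort i a c x y w \<Rightarrow>
       K0 + (base i x y - base 0 (px 0) (py 0)) + 2 * int b * (3 * (int r)\<^sup>2 - ip w1 w1) + 1 +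
       (if c \<noteq> c0 then 0
        else if a = a0 \<and> x = px (Suc i) \<and> y = py i then if w = w2 then z Z (Suc i) else z Z i
        else 2 * int b)
   | Tgt j \<Rightarrow> if j \<le> j0 then K1 + int (off j0) + int j0 - int j else K1)"

lemma base_add_left: "base i (x + w) y = base i x y + 4 * int b * ip w1 w"
  by (simp add: base_def ip_add algebra_simps)

lemma base_Suc_add_right: "base (Suc i) x (y + w) = base i x y +
   12 * int b * (int r)\<^sup>2 + 1 - 2 * int b * (ip w1 w1 + ip w2 w2) + 4 * int b * ip w2 w"
  by (simp add: base_def ip_add algebra_simps)

lemma base_end: "base h (px h) (py h) - base 0 (px 0) (py 0) = int h * int len"
proof -
  have "int len = 12 * int b * (int r)\<^sup>2 + 1 + 2 * int b * (ip w1 w1 + ip w2 w2)"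
    by (simp add: len_def int_ell algebra_simps)
  then show ?thesis
    by (simp add: base_def px_eq[of h] py_eq[of h] ip_add ip_smul algebra_simps)
qed

lemma base_variation:
  assumes "k < N" "k' < N"
  shows "\<bar>base i (fst (pos k)) (snd (pos k)) - base i (fst (pos k')) (snd (pos k'))\<bar> \<le> int V"
proof -
  let ?S = "\<lambda>k. ip w1 (fst (enum (k div q))) + ip w2 (snd (enum (k div q)))"
  have S: "0 \<le> ?S k" "?S k \<le> 12 * (int r)\<^sup>2" if "k < N" for k
    using ip_box[OF w1 enum_box(1)[OF that]] ip_box[OF w2 enum_box(2)[OF that]]
    by (simp_all add: power2_eq_square)
  have "base i (fst (pos k)) (snd (pos k)) - base i (fst (pos k')) (snd (pos k')) =
      4 * int b * int h * (?S k - ?S k')"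
    by (simp add: base_def pos_def map_prod_def split_beta ip_smul algebra_simps)
  moreover have "\<bar>4 * int b * int h * (?S k - ?S k')\<bar> \<le> 4 * int b * int h * (12 * (int r)\<^sup>2)"
    unfolding abs_mult using S[OF assms(1)] S[OF assms(2)]
    by (intro mult_mono) (auto simp: abs_if)
  ultimately show ?thesis by (simp add: V_def)
qed

text \<open>\<open>D\<close> stands for the difference of \<open>base\<close> to the selected hub
  and \<open>t\<close> for the correction. The selected exit is tight, exits behind the fault need
  only \<open>V + 2 * b\<close>, and earlier exits need the drop of \<open>off\<close>.\<close>

lemma Src_hub_bound:
  assumes "k < N" "\<bar>D\<bar> \<le> int V" "0 \<le> t" "t \<le> 2 * int b"
    and "k div q = k0 div q \<Longrightarrow> D = 0" "k = k0 \<Longrightarrow> t = 0"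
  shows "\<bar>K0 + D + t - (if k \<le> k0 then int k else K0)\<bar> \<le> int (off k)"
proof (cases k k0 rule: linorder_cases)
  case equal
  then show ?thesis using assms by (simp add: K0_def)
next
  case greater
  then show ?thesis using assms off_ge[of k] by simp
next
  case less
  have g: "2 * int b + (int k0 - int k) \<le> (int k0 - int k) * (2 * int b + 1)"
    using mult_right_mono[of 1 "int k0 - int k" "2 * int b"] less by (simp add: algebra_simps)
  \<comment> \<open>For a copy of the same end point \<open>D\<close> vanishes; otherwise the
    additional \<open>V\<close> of \<open>off_gap\<close> absorbs it.\<close>
  have "D + int (off k0) + (int k0 - int k) * (2 * int b + 1) \<le> int (off k)"
    using off_gap[OF less k0] assms(2,5) by (cases "k div q = k0 div q") auto
  then show ?thesis
    using g less assms off_ge[of k] by (simp add: K0_def abs_le_iff)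
qed

text \<open>Mirrors the source side, except that the correction has reached its full value
  \<open>2 * b\<close> at the selected hub.\<close>

lemma Tgt_hub_bound:
  assumes "k < N" "\<bar>D\<bar> \<le> int V" "0 \<le> t" "t \<le> 2 * int b"
    and "k div q = j0 div q \<Longrightarrow> D = 0" "k = j0 \<Longrightarrow> t = 2 * int b"
  shows "\<bar>(if k \<le> j0 then K1 + int (off j0) + int j0 - int k else K1) -
     (K1 - 2 * int b + D + t)\<bar> \<le> int (off k)"
proof (cases k j0 rule: linorder_cases)
  case equal
  then show ?thesis using assms by simp
next
  case greater
  then show ?thesis using assms off_ge[of k] by (simp add: abs_le_iff)
next
  case less
  have g: "2 * int b + (int j0 - int k) \<le> (int j0 - int k) * (2 * int b + 1)"
    using mult_right_mono[of 1 "int j0 - int k" "2 * int b"] less by (simp add: algebra_simps)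
  have "- D + int (off j0) + (int j0 - int k) * (2 * int b + 1) \<le> int (off k)"
    using off_gap[OF less j0] assms(2,5) by (cases "k div q = j0 div q") auto
  then show ?thesis
    using g less assms off_ge[of k] by (simp add: abs_le_iff)
qed

context
  fixes Z assumes Z: "Z \<subseteq> {..<h}" "card Z = b"
begin

lemma z_0: "z Z 0 = 0"
  by (simp add: z_def)

lemma z_h: "z Z h = 2 * int b"
  using Z by (simp add: z_def Int_absorb2)

lemma finite_Z: "finite Z"
  using Z finite_subset by blast

lemma z_bounds: "0 \<le> z Z i" "z Z i \<le> 2 * int b"
  using finite_Z Z(2) card_mono[of Z "Z \<inter> {..<i}"] by (auto simp: z_def)

lemma z_Suc: "z Z (Suc i) = z Z i + (if i \<in> Z then 2 else 0)"
proof -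
  have "Z \<inter> {..<Suc i} = (if i \<in> Z then insert i (Z \<inter> {..<i}) else Z \<inter> {..<i})"
    by (auto simp: less_Suc_eq)
  then show ?thesis by (simp add: z_def)
qed

lemma \<theta>_bounds: "0 \<le> \<theta> Z i a c x y" "\<theta> Z i a c x y \<le> 2 * int b"
  using z_bounds by (auto simp: \<theta>_def)

text \<open>Layers 0 and \<open>h\<close> forget one copy index, so the value must not depend on it.
  In layer \<open>h\<close> this holds because \<open>z Z h\<close> equals the off-path value
  \<open>2 * b\<close>; in layer 0 the guard \<open>0 < i\<close> ignores \<open>c\<close>.\<close>

lemma \<phi>_hub: "\<phi> Z (hub i a c x y) = K0 + (base i x y - base 0 (px 0) (py 0)) +
    (if 0 < i \<and> c \<noteq> c0 then 0
     else if i < h \<longrightarrow> a = a0 \<and> x = px i \<and> y = py i then z Z i else 2 * int b)"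
  if "i \<le> h"
  using that h_pos z_h z_0 by (auto simp: \<phi>_def hub_def \<theta>_def)

lemma \<phi>_gap: "\<phi> Z (Tgt 0) - \<phi> Z (Src 0) =
    int (k0 + off k0 + h * len + off j0 + j0) + 2 * int b"
  by (simp add: \<phi>_def K1_def K0_def)

lemma \<phi>_lipschitz:
  assumes "arc u v l" "{u, v} \<notin> faults \<union> crit k0 j0 ` Z"
  shows "\<bar>\<phi> Z v - \<phi> Z u\<bar> \<le> int l"
  using assms
proof cases
  case (arc_src k)
  then have "k \<noteq> k0" using assms(2) by (auto simp: faults_def)
  then show ?thesis using arc_src by (auto simp: \<phi>_def)
next
  case (arc_tgt k)
  then have "k \<noteq> j0" using assms(2) by (auto simp: faults_def)
  then show ?thesis using arc_tgt by (auto simp: \<phi>_def)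
next
  case (arc_exit k)
  let ?D = "base 0 (fst (pos k)) (snd (pos k)) - base 0 (px 0) (py 0)"
  have "\<bar>?D\<bar> \<le> int V"
    using base_variation[OF arc_exit(4) k0, of 0] pos_k0 by simp
  moreover have "?D = 0" if "k div q = k0 div q"
    using that pos_k0 by (simp add: pos_def)
  moreover have "\<theta> Z 0 (k mod q) 0 (fst (pos k)) (snd (pos k)) = 0" if "k = k0"
    using that pos_k0 z_0 by (simp add: \<theta>_def)
  ultimately have "\<bar>K0 + ?D + \<theta> Z 0 (k mod q) 0 (fst (pos k)) (snd (pos k)) -
      (if k \<le> k0 then int k else K0)\<bar> \<le> int (off k)"
    using arc_exit \<theta>_bounds by (intro Src_hub_bound) auto
  then show ?thesis using arc_exit h_pos by (simp add: \<phi>_def hub_def)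
next
  case (arc_enter k)
  let ?D = "base h (fst (pos k)) (snd (pos k)) - base h (px h) (py h)"
  let ?t = "if k mod q = c0 then 2 * int b else 0"
  have "\<bar>?D\<bar> \<le> int V"
    using base_variation[OF arc_enter(4) j0, of h] pos_j0 by simp
  moreover have "?D = 0" if "k div q = j0 div q"
    using that pos_j0 by (simp add: pos_def)
  ultimately have "\<bar>(if k \<le> j0 then K1 + int (off j0) + int j0 - int k else K1) -
     (K1 - 2 * int b + ?D + ?t)\<bar> \<le> int (off k)"
    using arc_enter by (intro Tgt_hub_bound) auto
  moreover have "\<phi> Z u = K1 - 2 * int b + ?D + ?t"
    using arc_enter h_pos z_h base_end by (simp add: \<phi>_hub K1_def)
  ultimately show ?thesis using arc_enter by (simp add: \<phi>_def)
next
  case (arc_left i a c x y w)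
  define T where "T = (if c \<noteq> c0 then 0
    else if a = a0 \<and> x + w = px (Suc i) \<and> y = py i then if w = w1 then z Z i else z Z (Suc i)
    else 2 * int b)"
  define T' where "T' = (if 0 < i \<and> c \<noteq> c0 then 0
     else if i < h \<longrightarrow> a = a0 \<and> x = px i \<and> y = py i then z Z i else 2 * int b)"
  have "0 \<le> T" "T \<le> 2 * int b" "0 \<le> T'" "T' \<le> 2 * int b"
    by (simp_all add: T_def T'_def z_bounds)
  then have "\<bar>T - T'\<bar> \<le> 2 * int b" by linarith
  \<comment> \<open>A step of slope \<open>w1\<close> stays on the path or off it, so the correction
    is kept if \<open>c = c0\<close>; for other \<open>c\<close> it becomes 0.\<close>
  moreover have "T - T' \<le> 0" if "w = w1"
  proof -
    have "x + w = px (Suc i) \<longleftrightarrow> x = px i" using that by (simp add: px_Suc)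
    then have "T = (if c \<noteq> c0 then 0 else if a = a0 \<and> x = px i \<and> y = py i then z Z i else 2 * int b)"
      unfolding T_def by (simp only: that if_True refl)
    moreover have "T' = (if 0 < i \<and> c \<noteq> c0 then 0
        else if a = a0 \<and> x = px i \<and> y = py i then z Z i else 2 * int b)"
      unfolding T'_def by (simp only: arc_left(4) simp_thms)
    ultimately show ?thesis using \<open>0 \<le> T'\<close> by (cases "c \<noteq> c0") simp_all
  qed
  moreover have "\<phi> Z v = K0 + (base i (x + w) y - base 0 (px 0) (py 0)) +
      2 * int b * (3 * (int r)\<^sup>2 - ip w1 w1) + T"
    using arc_left(2) by (simp add: \<phi>_def T_def)
  moreover have "\<phi> Z u = K0 + (base i x y - base 0 (px 0) (py 0)) + T'"
    unfolding arc_left(1) T'_def using arc_left(4) by (intro \<phi>_hub) simp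
  ultimately have "\<bar>2 * int b * (3 * (int r)\<^sup>2) + 4 * int b * ip w1 w - 2 * int b * ip w1 w1 + (T - T')\<bar>
      \<le> int (ell w)"
    and "\<phi> Z v - \<phi> Z u =
      2 * int b * (3 * (int r)\<^sup>2) + 4 * int b * ip w1 w - 2 * int b * ip w1 w1 + (T - T')"
    using step_bound[of w w1 "T - T'"] arc_left(9) w1
    by (simp_all add: base_add_left right_diff_distrib)
  then show ?thesis
    using arc_left(3) by simp
next
  case (arc_right i a c x y w)
  define T where "T = (if 0 < Suc i \<and> c \<noteq> c0 then 0
     else if Suc i < h \<longrightarrow> a = a0 \<and> x = px (Suc i) \<and> y + w = py (Suc i) then z Z (Suc i)
     else 2 * int b)"
  define T' where "T' = (if c \<noteq> c0 then 0
     else if a = a0 \<and> x = px (Suc i) \<and> y = py i then if w = w2 then z Z (Suc i) else z Z i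
     else 2 * int b)"
  have end_value: "z Z (Suc i) = 2 * int b" if "\<not> Suc i < h"
    using that arc_right(4) z_h by (metis Suc_leI le_antisym not_less)
  then have "T - T' \<le> 0" if "w = w2"
  proof -
    have "y + w = py (Suc i) \<longleftrightarrow> y = py i" using that by (simp add: py_Suc)
    then have "T' = (if c \<noteq> c0 then 0
        else if a = a0 \<and> x = px (Suc i) \<and> y + w = py (Suc i) then z Z (Suc i) else 2 * int b)"
      unfolding T'_def by (simp only: that if_True refl)
    moreover have "T = (if c \<noteq> c0 then 0
        else if Suc i < h \<longrightarrow> a = a0 \<and> x = px (Suc i) \<and> y + w = py (Suc i) then z Z (Suc i)
        else 2 * int b)"
      unfolding T_def by (simp only: zero_less_Suc simp_thms)
    ultimately show ?thesis
      using end_value z_bounds[of "Suc i"] by (cases "c \<noteq> c0"; cases "Suc i < h") (simp_all split: if_splits)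
  qed
  moreover have "0 \<le> T" "T \<le> 2 * int b" "0 \<le> T'" "T' \<le> 2 * int b"
    by (simp_all add: T_def T'_def z_bounds)
  then have "\<bar>T - T'\<bar> \<le> 2 * int b" by linarith
  moreover have "\<phi> Z v = K0 + (base (Suc i) x (y + w) - base 0 (px 0) (py 0)) + T"
    unfolding arc_right(2) T_def using arc_right(4) by (intro \<phi>_hub) simp
  moreover have "\<phi> Z u = K0 + (base i x y - base 0 (px 0) (py 0)) +
      2 * int b * (3 * (int r)\<^sup>2 - ip w1 w1) + 1 + T'"
    using arc_right(1) by (simp add: \<phi>_def T'_def)
  ultimately have "\<bar>2 * int b * (3 * (int r)\<^sup>2) + 4 * int b * ip w2 w - 2 * int b * ip w2 w2 + (T - T')\<bar>
      \<le> int (ell w)"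
    and "\<phi> Z v - \<phi> Z u =
      2 * int b * (3 * (int r)\<^sup>2) + 4 * int b * ip w2 w - 2 * int b * ip w2 w2 + (T - T')"
    using step_bound[of w w2 "T - T'"] arc_right(10) w2
    by (simp_all add: base_Suc_add_right right_diff_distrib distrib_left)
  then show ?thesis
    using arc_right(3) by simp
next
  case (arc_turn i a c x w y w')
  \<comment> \<open>Besides the correction a turn contributes 1. A rise by 2 occurs only at the
    critical turn of a round in \<open>Z\<close>; a drop by 2, between ports whose slopes both
    differ from the selected ones, gives the admissible -1.\<close>
  have "i \<notin> Z" if "a = a0" "c = c0" "x + w = px (Suc i)" "y = py i" "w = w1" "w' = w2"
    using that assms(2) arc_turn by (auto simp: crit_eq px_Suc)
  then show ?thesis
    using arc_turn z_Suc[of i] by (auto simp: \<phi>_def)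
qed

end

end

section \<open>The selected route in the subdivided graph\<close>

locale grid_graph = grid +
  fixes X :: "nat set"
  assumes finite_X': "finite X"
    and pt_in_X': "arc u v l \<Longrightarrow> j \<le> l \<Longrightarrow> pt u v l j \<in> X"
begin

sublocale subdivision arc X
proof
  fix u v l assume arc: "arc u v l"
  show "u \<noteq> v" using arc by cases (auto simp: hub_def)
  have off_pos: "0 < off k" for k using b_pos by (simp add: off_def)
  show "0 < l" using arc by cases (simp_all add: off_pos ell_pos)
qed (use finite_X' pt_in_X' in auto)

end

locale graph_test = grid_graph b h r q enum X + grid_test b h r q enum k0 j0
  for b h r q enum X k0 j0
begin

lemma source_path:
  "n \<le> k0 \<Longrightarrow> path_avoiding faults (Src (k0 - n)) (hub 0 a0 c0 (px 0) (py 0)) (n + off k0)"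
proof (induction n)
  case 0
  have "arc (Src k0) (hub 0 a0 c0 (px 0) (py 0)) (off k0)"
    using arc_exit[OF k0] h_pos by (simp add: pos_k0 hub_def)
  then show ?case
    using arcI by (simp add: faults_def hub_def doubleton_eq_iff)
next
  case (Suc n)
  then have "arc (Src (k0 - Suc n)) (Src (k0 - n)) 1"
    using arc_src[of "k0 - Suc n"] k0 by (simp add: Suc_diff_Suc)
  then have "path_avoiding faults (Src (k0 - Suc n)) (Src (k0 - n)) 1"
    using Suc.prems by (intro arcI) (auto simp: faults_def doubleton_eq_iff)
  with Suc show ?case using transI by fastforce
qed

lemma target_path:
  "n \<le> j0 \<Longrightarrow> path_avoiding faults (hub h a0 c0 (px h) (py h)) (Tgt (j0 - n)) (off j0 + n)"
proof (induction n)
  case 0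
  have "arc (hub h a0 c0 (px h) (py h)) (Tgt j0) (off j0)"
    using arc_enter[OF j0] h_pos by (simp add: pos_j0 hub_def)
  then show ?case
    using arcI by (simp add: faults_def hub_def doubleton_eq_iff)
next
  case (Suc n)
  then have "arc (Tgt (j0 - n)) (Tgt (j0 - Suc n)) 1"
    using arc_tgt[of "j0 - Suc n"] j0 by (simp add: Suc_diff_Suc)
  then have "path_avoiding faults (Tgt (j0 - n)) (Tgt (j0 - Suc n)) 1"
    using Suc.prems by (intro arcI) (auto simp: faults_def doubleton_eq_iff)
  with Suc show ?case using transI by fastforce
qed

lemma not_fault: "u \<notin> range Src \<Longrightarrow> u \<notin> range Tgt \<Longrightarrow> {u, v} \<notin> faults"
  by (auto simp: faults_def doubleton_eq_iff)

lemma round_path: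
  assumes "i < h"
  shows "path_avoiding faults (hub i a0 c0 (px i) (py i)) (hub (Suc i) a0 c0 (px (Suc i)) (py (Suc i))) len"
proof -
  note in_M = px_in[of i] py_in[of i] px_in[of "Suc i"] py_in[of "Suc i"]
  have "a0 < q" "c0 < q" using q_pos by auto
  then have arcs: "arc (hub i a0 c0 (px i) (py i)) (LPort i a0 c0 (px i) (py i) w1) (ell w1)"
    "arc (LPort i a0 c0 (px i) (py i) w1) (RPort i a0 c0 (px i + w1) (py i) w2) 1"
    "arc (RPort i a0 c0 (px (Suc i)) (py i) w2) (hub (Suc i) a0 c0 (px (Suc i)) (py i + w2)) (ell w2)"
    using assms in_M w1 w2 by (intro arc_left arc_turn arc_right; simp add: px_Suc py_Suc)+
  have "path_avoiding faults (hub i a0 c0 (px i) (py i)) (LPort i a0 c0 (px i) (py i) w1) (ell w1)"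
    by (rule arcI[OF arcs(1) not_fault]) (auto simp: hub_def)
  moreover have "path_avoiding faults (LPort i a0 c0 (px i) (py i) w1) (RPort i a0 c0 (px (Suc i)) (py i) w2) 1"
    unfolding px_Suc by (rule arcI[OF arcs(2) not_fault]) auto
  moreover have "path_avoiding faults (RPort i a0 c0 (px (Suc i)) (py i) w2)
       (hub (Suc i) a0 c0 (px (Suc i)) (py (Suc i))) (ell w2)"
    unfolding py_Suc by (rule arcI[OF arcs(3) not_fault]) auto
  ultimately show ?thesis
    unfolding len_def by (intro transI)
qed

text \<open>This length is the difference of \<open>\<phi> Z\<close> between the two ends, less the
  correction \<open>2 * b\<close>.\<close>

lemma test_path: "path_avoiding faults (Src 0) (Tgt 0) (k0 + off k0 + h * len + off j0 + j0)"
proof -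
  have "path_avoiding faults (Src 0) (hub i a0 c0 (px i) (py i)) (k0 + off k0 + i * len)" if "i \<le> h" for i
    using that
  proof (induction i)
    case 0
    then show ?case using source_path[of k0] by simp
  next
    case (Suc i)
    then show ?case
      using transI[OF _ round_path[of i], of "Src 0" "k0 + off k0 + i * len"] by (simp add: ac_simps)
  qed
  from transI[OF this[OF order_refl] target_path[OF order_refl]] show ?thesis
    by (simp add: ac_simps)
qed

lemma few_missing:
  assumes "additive_ft_preserver 2 \<beta> G (nd (Src 0)) (nd (Tgt 0)) H" "\<beta> < 2 * real b"
  shows "card {i \<in> {..<h}. nd ` crit k0 j0 i \<notin> edges H} < b"
proof (rule few_missing_edges[OF assms(1) _ _ _ test_path _ assms(2)])
  show "finite faults" by (simp add: faults_def)
  show "card faults \<le> 2" by (simp add: faults_def card_insert_if)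
  show "\<exists>u v. e = {u, v} \<and> arc u v 1" if "e \<in> faults" for e
    using that arc_src[OF k0] arc_tgt[OF j0] unfolding faults_def by blast
  show "l = 1" if "arc u v l" "{u, v} \<in> faults \<union> crit k0 j0 ` {..<h}" for u v l
    using that by cases (auto simp: faults_def crit_eq hub_def doubleton_eq_iff)
  show "\<exists>\<phi> :: node \<Rightarrow> int. \<phi> (Tgt 0) - \<phi> (Src 0) =
           int (k0 + off k0 + h * len + off j0 + j0) + 2 * int b \<and>
         (\<forall>u v l. arc u v l \<longrightarrow> {u, v} \<notin> faults \<union> crit k0 j0 ` Z \<longrightarrow> \<bar>\<phi> v - \<phi> u\<bar> \<le> int l)"
    if "Z \<subseteq> {..<h}" "card Z = b" for Z
    using \<phi>_gap[OF that] \<phi>_lipschitz[OF that] by blast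
qed simp

end

section \<open>Counting selected pairs, critical turns and vertices\<close>

context grid
begin

definition "tests = {(k, j). k < N \<and> j < N \<and> dir k j \<in> box (int r) \<times> box (int r)}"

lemma finite_tests: "finite tests"
  by (rule finite_subset[of _ "{..<N} \<times> {..<N}"]) (auto simp: tests_def)

text \<open>Both copies, a start and a slope can be chosen freely with start and slope in boxes of
  side \<open>r\<close>: their sum stays in the boxes of side \<open>2 * r\<close>, so it is an
  enumerated end point.\<close>

lemma card_tests: "q\<^sup>2 * r ^ 12 \<le> card tests"
proof -
  let ?A = "{..<q} \<times> {..<q} \<times> (box (int r) \<times> box (int r)) \<times> (box (int r) \<times> box (int r))"
  let ?g = "\<lambda>(k, j). (k mod q, j mod q, enum (k div q), dir k j)"
  have idx: "\<exists>k<N. k mod q = a \<and> enum (k div q) = p"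
    if "a < q" "p \<in> box (int (2 * r)) \<times> box (int (2 * r))" for a p
  proof -
    have "p \<in> enum ` {..<(2 * r) ^ 6}"
      using that(2) by (simp only: bij_betw_imp_surj_on[OF bij_enum])
    then obtain n where n: "n < (2 * r) ^ 6" "enum n = p" by auto
    have "q * n + a < q * Suc n" using \<open>a < q\<close> by simp
    also have "\<dots> \<le> N"
      unfolding N_def using Suc_leI[OF n(1)] by (rule mult_left_mono) simp
    finally show ?thesis
      using n \<open>a < q\<close> by (intro exI[of _ "q * n + a"]) simp
  qed
  have "?A \<subseteq> ?g ` tests"
  proof
    fix e assume "e \<in> ?A"
    then obtain a c p w where e: "e = (a, c, p, w)" "a < q" "c < q"
      and pw: "p \<in> box (int r) \<times> box (int r)" "w \<in> box (int r) \<times> box (int r)"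
      by auto
    have "p \<in> box (int (2 * r)) \<times> box (int (2 * r))" "p + w \<in> box (int (2 * r)) \<times> box (int (2 * r))"
      using pw by (auto simp: box_def)
    then obtain k j where "k < N" "k mod q = a" "enum (k div q) = p"
      "j < N" "j mod q = c" "enum (j div q) = p + w"
      using idx e(2,3) by meson
    then have "(k, j) \<in> tests" "e = ?g (k, j)"
      using e pw by (simp_all add: tests_def dir_def)
    then show "e \<in> ?g ` tests" by (rule rev_image_eqI)
  qed
  then have "card ?A \<le> card tests"
    using surj_card_le[OF finite_tests] by blast
  moreover have "card ?A = q\<^sup>2 * r ^ 12"
    by (simp add: card_cartesian_product card_box power2_eq_square flip: power_add)
  ultimately show ?thesis by simp
qed

text \<open>The ports store the round, the copies, the position and both slopes. Going back
  \<open>i\<close> steps recovers \<open>pos k\<close>, adding the slopes recovers the end point of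
  \<open>j\<close>, and the copies complete the indices.\<close>

lemma crit_inject:
  assumes "(k, j) \<in> tests" "(k', j') \<in> tests" "crit k j i = crit k' j' i'"
  shows "k = k' \<and> j = j' \<and> i = i'"
proof -
  have eq: "i = i'" "k mod q = k' mod q" "j mod q = j' mod q"
    "point k j i = point k' j' i" "dir k j = dir k' j'"
    using assms(3) by (auto simp: crit_def doubleton_eq_iff prod_eq_iff)
  have "pos k = pos k'"
    using eq(4,5) by (simp add: point_def)
  then have "enum (k div q) = enum (k' div q)"
    using h_pos by (simp add: pos_def map_prod_def split_beta prod_eq_iff[of "enum _"] smul_inject)
  moreover from this have "enum (j div q) = enum (j' div q)"
    using eq(5) by (simp add: dir_def)
  ultimately have "k div q = k' div q" "j div q = j' div q"
    using bij_betw_imp_inj_on[OF bij_enum] assms(1,2) div_q_less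
    by (auto simp: tests_def inj_on_def)
  then show ?thesis
    using eq by (metis div_mult_mod_eq)
qed

definition "points = {pt u v l j |u v l j. arc u v l \<and> j \<le> l}"

lemma ell_le: "w \<in> box (int r) \<Longrightarrow> ell w \<le> 12 * b * r\<^sup>2"
proof -
  assume "w \<in> box (int r)"
  then have "2 * int b * (3 * (int r)\<^sup>2 + ip w w) \<le> 2 * int b * (3 * (int r)\<^sup>2 + 3 * (int r)\<^sup>2)"
    using ip_box(2)[of w "int r" w "int r"] by (intro mult_left_mono) (auto simp: power2_eq_square)
  then have "int (ell w) \<le> int (12 * b * r\<^sup>2)" by (simp add: int_ell)
  then show ?thesis by (simp only: of_nat_le_iff)
qed

lemma off_le: "off k \<le> off 0"
  unfolding off_def by (intro add_mono mult_mono) auto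

text \<open>The ends of a turn are ends of step arcs, so turns add no vertices. Hence only one
  slope, a factor \<open>r ^ 3\<close>, enters the count, although turns range over pairs of
  slopes.\<close>

lemma points_bound:
  "finite points \<and>
   card points \<le> 2 * (N + 1) + 2 * (N * (off 0 + 1)) +
     2 * (h * q\<^sup>2 * (2 * h * r) ^ 6 * r ^ 3 * (12 * b * r\<^sup>2 + 1))"
proof -
  let ?I = "{..<N} \<times> {..off 0}"
  let ?J = "{..<h} \<times> {..<q} \<times> {..<q} \<times> M \<times> M \<times> box (int r) \<times> {..12 * b * r\<^sup>2}"
  let ?S = "(\<lambda>k. nd (Src k)) ` {..N}" and ?T = "(\<lambda>k. nd (Tgt k)) ` {..N}"
  let ?E = "(\<lambda>(k, j). pt (Src k) (hub 0 (k mod q) 0 (fst (pos k)) (snd (pos k))) (off k) j) ` ?I"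
  let ?F = "(\<lambda>(k, j). pt (hub h 0 (k mod q) (fst (pos k)) (snd (pos k))) (Tgt k) (off k) j) ` ?I"
  let ?L = "(\<lambda>(i, a, c, x, y, w, j). pt (hub i a c x y) (LPort i a c x y w) (ell w) j) ` ?J"
  let ?R = "(\<lambda>(i, a, c, x, y, w, j). pt (RPort i a c x y w) (hub (Suc i) a c x (y + w)) (ell w) j) ` ?J"
  have "p \<in> ?S \<union> ?T \<union> ?E \<union> ?F \<union> ?L \<union> ?R" if "arc u v l" "j \<le> l" and p: "p = pt u v l j" for p u v l j
    using that(1)
  proof cases
    case (arc_src k)
    then have "p \<in> ?S" using p that(2) by (auto simp: pt_def)
    then show ?thesis by blast
  next
    case (arc_tgt k)
    then have "p \<in> ?T" using p that(2) by (auto simp: pt_def)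
    then show ?thesis by blast
  next
    case (arc_exit k)
    then have "p \<in> ?E" using p that(2) off_le[of k] by (intro image_eqI[of _ _ "(k, j)"]) auto
    then show ?thesis by blast
  next
    case (arc_enter k)
    then have "p \<in> ?F" using p that(2) off_le[of k] by (intro image_eqI[of _ _ "(k, j)"]) auto
    then show ?thesis by blast
  next
    case (arc_left i a c x y w)
    then have "p \<in> ?L"
      using p that(2) ell_le[of w] by (intro image_eqI[of _ _ "(i, a, c, x, y, w, j)"]) auto
    then show ?thesis by blast
  next
    case (arc_right i a c x y w)
    then have "p \<in> ?R"
      using p that(2) ell_le[of w] by (intro image_eqI[of _ _ "(i, a, c, x, y, w, j)"]) auto
    then show ?thesis by blast
  next
    case (arc_turn i a c x w y w')
    then have "p = nd (LPort i a c x y w) \<or> p = nd (RPort i a c (x + w) y w')"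
      using p that(2) by (auto simp: pt_def)
    moreover have "nd (LPort i a c x y w) \<in> ?L"
      using arc_turn by (intro image_eqI[of _ _ "(i, a, c, x, y, w, ell w)"]) (auto simp: pt_def ell_le ell_pos less_imp_neq[OF ell_pos, symmetric])
    moreover have "nd (RPort i a c (x + w) y w') \<in> ?R"
      using arc_turn by (intro image_eqI[of _ _ "(i, a, c, x + w, y, w', 0)"]) (auto simp: pt_def)
    ultimately show ?thesis by blast
  qed
  then have sub: "points \<subseteq> ?S \<union> ?T \<union> ?E \<union> ?F \<union> ?L \<union> ?R"
    unfolding points_def by blast
  have fin: "finite ?I" "finite ?J" by simp_all
  have I: "card ?I = N * (off 0 + 1)" by (simp add: card_cartesian_product)
  have J: "card ?J = h * q\<^sup>2 * (2 * h * r) ^ 6 * r ^ 3 * (12 * b * r\<^sup>2 + 1)"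
  proof -
    have "(2 * h * r) ^ 6 = (2 * h * r) ^ 3 * (2 * h * r) ^ 3" by (simp flip: power_add)
    moreover have "card ?J = h * q * q * (card M * card M) * card (box (int r)) * (12 * b * r\<^sup>2 + 1)"
      by (simp only: card_cartesian_product card_lessThan card_atMost Suc_eq_plus1 mult.assoc)
    ultimately show ?thesis by (simp only: card_box power2_eq_square mult.assoc)
  qed
  have "card points \<le> card (?S \<union> ?T \<union> ?E \<union> ?F \<union> ?L \<union> ?R)"
    by (intro card_mono sub) (use fin in blast)
  also have "\<dots> \<le> card ?S + card ?T + card ?E + card ?F + card ?L + card ?R"
    by (intro order_trans[OF card_Un_le] add_mono order_refl)
  also have "\<dots> \<le> (N + 1) + (N + 1) + card ?I + card ?I + card ?J + card ?J"
    by (intro add_mono card_image_le fin order_trans[OF card_image_le]) auto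
  finally have "card points \<le> 2 * (N + 1) + 2 * card ?I + 2 * card ?J"
    by (simp only: mult_2[of "N + 1"] mult_2[of "card ?I"] mult_2[of "card ?J"] add.assoc)
  moreover have "finite points" by (rule finite_subset[OF sub]) (use fin in blast)
  ultimately show ?thesis unfolding I J by blast
qed

end

section \<open>Size of a preserver and choice of the parameters\<close>

text \<open>Each selected pair keeps at least \<open>h - b\<close> of its critical turns in
  \<open>H\<close>, and by injectivity different pairs keep different edges.\<close>

lemma (in grid_graph) preserver_size:
  assumes pres: "additive_ft_preserver 2 \<beta> G (nd (Src 0)) (nd (Tgt 0)) H" and "\<beta> < 2 * real b"
    and "finite (edges H)"
  shows "card tests * (h - b) \<le> card (edges H)"
proof -
  let ?K = "\<lambda>(k, j). {i \<in> {..<h}. nd ` crit k j i \<in> edges H}"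
  let ?f = "\<lambda>((k, j), i). nd ` crit k j i"
  have "h - b \<le> card (?K \<tau>)" if "\<tau> \<in> tests" for \<tau>
  proof -
    obtain k j where \<tau>: "\<tau> = (k, j)" by (cases \<tau>)
    interpret graph_test b h r q enum X k j
      by unfold_locales (use that \<tau> in \<open>auto simp: tests_def\<close>)
    let ?M = "{i \<in> {..<h}. nd ` crit k j i \<notin> edges H}"
    have "{..<h} = ?K \<tau> \<union> ?M"
      unfolding \<tau> by auto
    then have "card {..<h} = card (?K \<tau> \<union> ?M)" by (rule arg_cong)
    also have "\<dots> \<le> card (?K \<tau>) + card ?M" by (rule card_Un_le)
    finally show ?thesis
      using few_missing[OF pres assms(2)] by simp
  qed
  then have "card tests * (h - b) \<le> (\<Sum>\<tau>\<in>tests. card (?K \<tau>))"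
    using sum_mono[of tests "\<lambda>_. h - b"] by simp
  also have "\<dots> = card (Sigma tests ?K)"
    by (rule card_SigmaI[symmetric]) (use finite_tests in auto)
  also have "\<dots> = card (?f ` Sigma tests ?K)"
  proof (rule card_image[symmetric], rule inj_onI)
    fix x y assume xy: "x \<in> Sigma tests ?K" "y \<in> Sigma tests ?K" "?f x = ?f y"
    obtain k j i k' j' i' where "x = ((k, j), i)" "y = ((k', j'), i')"
      by (metis surj_pair)
    then show "x = y"
      using xy crit_inject[of k j k' j' i i'] by (auto simp: inj_image_eq_iff[OF inj_nd])
  qed
  also have "\<dots> \<le> card (edges H)"
    by (rule card_mono[OF assms(3)]) auto
  finally show ?thesis .
qed

text \<open>
  The exponents balance the \<open>q\<^sup>2 r\<^sup>1\<^sup>2 h\<close> critical edges against the \<open>O(h\<^sup>7 q\<^sup>2 r\<^sup>1\<^sup>1 b)\<close> vertices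
  of the grids and the \<open>O(q\<^sup>2 r\<^sup>1\<^sup>2 b)\<close> vertices of the trunks.
\<close>

lemma hard_graph:
  fixes b n :: nat
  assumes "2 \<le> b" and n: "1000000 * b ^ 231 \<le> n"
  shows "\<exists>(G :: nat ugraph) s t. simple_graph G \<and> card (verts G) = n \<and> s \<in> verts G \<and> t \<in> verts G \<and>
    (\<forall>\<beta> H. \<beta> < 2 * real b \<longrightarrow> additive_ft_preserver 2 \<beta> G s t H \<longrightarrow> b ^ 232 \<le> 2 * card (edges H))"
proof -
  \<comment> \<open>Here \<open>q^2 * r^12 * h\<close> is \<open>b ^ 232\<close>, while both vertex
    counts are of order \<open>b ^ 231\<close>. The jump \<open>V\<close> of order
    \<open>b ^ 31\<close> stays of lower order than \<open>q * (2 * b + 1)\<close>.\<close>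
  define h r q where "h = b ^ 2" and "r = b ^ 14" and "q = b ^ 31"
  let ?B = "box (int (2 * r)) \<times> box (int (2 * r))"
  have "card {..<(2 * r) ^ 6} = card ?B"
    unfolding card_cartesian_product card_box by (simp flip: power_add)
  then obtain enum where "bij_betw enum {..<(2 * r) ^ 6} ?B"
    using finite_same_card_bij[of "{..<(2 * r) ^ 6}" ?B] by auto
  then interpret grid b h r q enum
    using \<open>2 \<le> b\<close> by unfold_locales (auto simp: h_def r_def q_def)
  have N: "N = 64 * b ^ 115"
    unfolding N_def by (simp add: q_def r_def power_mult_distrib flip: power_mult power_add)
  have V: "V = 48 * b ^ 31"
    unfolding V_def by (simp add: h_def r_def flip: power_mult power_add power_Suc)
  have mono: "b ^ i \<le> b ^ j" if "i \<le> j" for i j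
    using that \<open>2 \<le> b\<close> by (intro power_increasing) auto
  \<comment> \<open>3315 is the sum of the coefficients of \<open>off 0 + 1\<close>, all powers
    being raised to \<open>b ^ 116\<close>.\<close>
  have off0: "off 0 + 1 \<le> 3315 * b ^ 116"
  proof -
    have "off 0 = 48 * b ^ 31 + 2 * b + (128 * b ^ 116 + 64 * b ^ 115) + 3072 * b ^ 115"
      unfolding off_def N V
      by (simp add: r_def power_mult_distrib algebra_simps flip: power_mult power_add power_Suc)
    then show ?thesis
      using mono[of 31 116] mono[of 1 116] mono[of 115 116] mono[of 0 116] by simp
  qed
  have "2 * (N + 1) \<le> 130 * b ^ 231"
    using mono[of 115 231] mono[of 0 231] unfolding N by simp
  moreover have "2 * (N * (off 0 + 1)) \<le> 424320 * b ^ 231"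
  proof -
    have "N * (off 0 + 1) \<le> 64 * b ^ 115 * (3315 * b ^ 116)"
      unfolding N by (intro mult_left_mono off0) simp
    also have "\<dots> = 212160 * b ^ 231"
      by (simp flip: power_add)
    finally show ?thesis by simp
  qed
  moreover have "2 * (h * q\<^sup>2 * (2 * h * r) ^ 6 * r ^ 3 * (12 * b * r\<^sup>2 + 1)) \<le> 1664 * b ^ 231"
  proof -
    have "b * r\<^sup>2 = b ^ 29"
      by (simp add: r_def flip: power_mult power_Suc)
    then have "12 * b * r\<^sup>2 + 1 \<le> 13 * b ^ 29"
      using mono[of 0 29] by (simp add: mult.assoc)
    then have "h * q\<^sup>2 * (2 * h * r) ^ 6 * r ^ 3 * (12 * b * r\<^sup>2 + 1) \<le>
        h * q\<^sup>2 * (2 * h * r) ^ 6 * r ^ 3 * (13 * b ^ 29)"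
      by (intro mult_left_mono) auto
    also have "\<dots> = 832 * b ^ 231"
      by (simp add: h_def q_def r_def power_mult_distrib flip: power_mult power_add)
    finally show ?thesis by simp
  qed
  ultimately have "card points \<le> n" "finite points"
    using points_bound n by linarith+
  \<comment> \<open>Isolated vertices outside \<open>points\<close> fill the order up to exactly
    \<open>n\<close>.\<close>
  then obtain Y where Y: "finite Y" "card Y = n - card points" "Y \<subseteq> - points"
    using infinite_arbitrarily_large[of "- points" "n - card points"] by (auto simp: finite_compl)
  define X where "X = points \<union> Y"
  have "points \<inter> Y = {}" using Y(3) by blast
  then have "card X = n" "finite X"
    using Y \<open>card points \<le> n\<close> \<open>finite points\<close> by (auto simp: X_def card_Un_disjoint)
  interpret grid_graph b h r q enum X
    using \<open>finite X\<close> by unfold_locales (auto simp: X_def points_def)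
  have "0 < N" using \<open>2 \<le> b\<close> by (simp add: N)
  then have "nd (Src 0) \<in> X" "nd (Tgt 0) \<in> X"
    using pt_in_X[OF arc_src, of 0 0] pt_in_X[OF arc_tgt, of 0 1] by (simp_all add: pt_def)
  moreover have "b ^ 232 \<le> 2 * card (edges H)"
    if "\<beta> < 2 * real b" "additive_ft_preserver 2 \<beta> G (nd (Src 0)) (nd (Tgt 0)) H" for \<beta> H
  proof -
    have "edges H \<subseteq> Pow (verts H)" "finite (verts H)"
      using that(2) by (auto simp: additive_ft_preserver_def subgraph_def simple_graph_def)
    then have "finite (edges H)" by (meson finite_Pow_iff finite_subset)
    have "b ^ 230 * (h - b) \<le> card tests * (h - b)"
      using card_tests by (intro mult_right_mono) (auto simp: q_def r_def simp flip: power_mult power_add)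
    also have "\<dots> \<le> card (edges H)"
      using preserver_size[OF that(2,1) \<open>finite (edges H)\<close>] .
    finally have "b ^ 230 * (2 * (h - b)) \<le> 2 * card (edges H)" by simp
    \<comment> \<open>\<open>h - b = b * (b - 1)\<close> is at least half of
      \<open>b\<^sup>2\<close> because \<open>2 \<le> b\<close>.\<close>
    moreover have "b\<^sup>2 \<le> 2 * (h - b)"
      using mult_right_mono[OF \<open>2 \<le> b\<close>, of b] unfolding h_def power2_eq_square by linarith
    then have "b ^ 230 * b\<^sup>2 \<le> b ^ 230 * (2 * (h - b))" by (intro mult_left_mono) auto
    moreover have "b ^ 230 * b\<^sup>2 = b ^ 232" by (simp flip: power_add)
    ultimately show ?thesis by linarith
  qed
  moreover have "verts G = X" by (simp add: G_def)
  ultimately show ?thesis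
    using simple_G \<open>card X = n\<close> by metis
qed

theorem theorem5:
  "\<exists>\<epsilon> \<delta> c :: real. \<epsilon> > 0 \<and> \<delta> > 0 \<and> c > 0 \<and>
     (\<forall>\<^sub>F n in sequentially.
        \<exists>(G :: nat ugraph) s t.
          simple_graph G \<and> card (verts G) = n \<and> s \<in> verts G \<and> t \<in> verts G \<and>
          (\<forall>H. additive_ft_preserver 2 (real n powr \<delta>) G s t H \<longrightarrow>
                 real (card (edges H)) \<ge> c * real n powr (1 + \<epsilon>)))"
proof -
  \<comment> \<open>\<open>?y n\<close> solves \<open>1000000 * y ^ 231 = n\<close>, and rounding
    down to \<open>b\<close> loses less than 1. As 1/300 is below 1/231, the stretch
    \<open>n powr (1 / 300)\<close> stays below \<open>2 * b\<close>, and \<open>b ^ 232\<close>, of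
    order \<open>n powr (232 / 231)\<close>, exceeds
    \<open>2 * n powr (1 + 1 / 300)\<close>.\<close>
  let ?y = "\<lambda>n::nat. (real n / 1000000) powr (1 / 231)"
  have ev1: "\<forall>\<^sub>F n in sequentially. 3 \<le> ?y n" by real_asymp
  have ev2: "\<forall>\<^sub>F n::nat in sequentially. real n powr (1 / 300) < 2 * (?y n - 1)" by real_asymp
  have ev3: "\<forall>\<^sub>F n::nat in sequentially. 2 * real n powr (1 + 1 / 300) \<le> (?y n - 1) powr 232"
    by real_asymp
  have "\<forall>\<^sub>F n in sequentially. \<exists>(G :: nat ugraph) s t.
          simple_graph G \<and> card (verts G) = n \<and> s \<in> verts G \<and> t \<in> verts G \<and>
          (\<forall>H. additive_ft_preserver 2 (real n powr (1 / 300)) G s t H \<longrightarrow>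
                 real (card (edges H)) \<ge> 1 * real n powr (1 + 1 / 300))"
    using ev1 ev2 ev3
  proof eventually_elim
    case (elim n)
    define b where "b = nat \<lfloor>?y n\<rfloor>"
    have b: "?y n - 1 \<le> real b" "real b \<le> ?y n" "2 \<le> b"
      using elim(1) unfolding b_def by linarith+
    have "real b ^ 231 \<le> ?y n ^ 231"
      using b(2) by (intro power_mono) auto
    also have "\<dots> = ?y n powr real 231"
      using elim(1) by (intro powr_realpow[symmetric]) linarith
    also have "\<dots> = real n / 1000000"
      by (simp add: powr_powr)
    finally have "real (1000000 * b ^ 231) \<le> real n" by simp
    then have "1000000 * b ^ 231 \<le> n" by (simp only: of_nat_le_iff)
    from hard_graph[OF b(3) this] obtain G :: "nat ugraph" and s t where
      G: "simple_graph G" "card (verts G) = n" "s \<in> verts G" "t \<in> verts G"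
        "\<And>\<beta> H. \<beta> < 2 * real b \<Longrightarrow> additive_ft_preserver 2 \<beta> G s t H \<Longrightarrow> b ^ 232 \<le> 2 * card (edges H)"
      by blast
    have "1 * real n powr (1 + 1 / 300) \<le> real (card (edges H))"
      if "additive_ft_preserver 2 (real n powr (1 / 300)) G s t H" for H
    proof -
      have "(?y n - 1) powr 232 \<le> real b powr 232"
        using b(1) elim(1) by (intro powr_mono2) auto
      also have "\<dots> = real (b ^ 232)"
        using b(3) by (simp only: of_nat_power) (intro powr_numeral, simp)
      also have "\<dots> \<le> real (2 * card (edges H))"
        unfolding of_nat_le_iff by (rule G(5)[OF order_less_le_trans[OF elim(2)] that]) (use b(1) in simp)
      finally show ?thesis using elim(3) by simp
    qed
    then show ?case using G(1-4) by blast
  qed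
  then show ?thesis
    by (intro exI[of _ "1 / 300"] exI[of _ 1]) auto
qed

end
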